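(* Let $0<a<b$ and $P\in\mathcal C^2_\psi(\Omega)$ with $a\le P(\omega)\le b$ for all $\omega\in\Omega$. For $\omega\in\Omega$ let $p_\omega(t)=P(\omega+\psi(t))$, $t\in\mathbb R$, and let $v_*=2\max\{\max_{\varpi\in\Omega}\partial_\psi P(\varpi),0\}$. Let $E_\omega$ be the escaping set of the ping-pong map with forcing $p=p_\omega$, i.e. the set of $(t_0,v_0)\in\mathbb R\times(v_*,\infty)$ for which the whole forward orbit $(t_n,v_n)_{n\in\mathbb N}$ is well defined (all $v_n>v_*$) and $\lim_{n\to\infty}v_n=\infty$. Then for $\mu_\Omega$-almost every $\omega\in\Omega$ the set $E_\omega\subset\mathbb R^2$ has Lebesgue measure zero.
   Context: $\Omega$ is a commutative (written additively), compact, metrizable topological group, and $\psi:\mathbb R\to\Omega$ is a continuous group homomorphism with $\psi(\mathbb R)$ dense; $\mu_\Omega$ is its Haar probability measure. For $U:\Omega\to\mathbb R$, $\partial_\psi U(\omega)=\lim_{t\to0}\frac{U(\omega+\psi(t))-U(\omega)}{t}$; $\mathcal C^2_\psi(\Omega)$ is the space of continuous $U$ such that $\partial_\psi U$ and $\partial_\psi^2U=\partial_\psi(\partial_\psi U)$ exist everywhere and are continuous on $\Omega$. Ping-pong map: for a forcing $p\in\mathcal C^2(\mathbb R)$ with $0<a\le p\le b$ and bounded $\dot p,\ddot p$, and $v_0>v_*:=2\max\{\sup_t\dot p(t),0\}$, the map $(t_0,v_0)\mapsto(t_1,v_1)$ is defined by letting $\tilde t$ be the unique solution of $(\tilde t-t_0)v_0=p(\tilde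 t)$ and setting $v_1=v_0-2\dot p(\tilde t)$, $t_1=\tilde t+p(\tilde t)/v_1$. (It describes a particle bouncing elastically between a fixed wall at $x=0$ and a moving wall at $x=p(t)$; $t_n,v_n$ are the times and post-impact velocities of successive impacts at $x=0$.) Orbits are $(t_n,v_n)$ obtained by iterating this map as long as $v_n>v_*$. *)

theory Defs
  imports "HOL-Analysis.Analysis" "HOL-Probability.Probability"
begin

(* Haar probability measure on a compact commutative group 'a:
   a translation-invariant Borel probability measure (unique on compact groups). *)
definition haar_prob :: "'a::{topological_ab_group_add, metric_space} measure \<Rightarrow> bool" where
  "haar_prob \<mu> \<longleftrightarrow> prob_space \<mu> \<and> sets \<mu> = sets borel \<and>
     (\<forall>c A. A \<in> sets borel \<longrightarrow> measure \<mu> ((\<lambda>x. c + x) ` A) = measure \<mu> A)"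

definition has_dpsi :: "(real \<Rightarrow> 'a::topological_ab_group_add) \<Rightarrow> ('a \<Rightarrow> real) \<Rightarrow> real \<Rightarrow> 'a \<Rightarrow> bool" where
  "has_dpsi \<psi> U D \<omega> \<longleftrightarrow> ((\<lambda>t. (U (\<omega> + \<psi> t) - U \<omega>) / t) \<longlongrightarrow> D) (at 0)"

definition dpsi :: "(real \<Rightarrow> 'a::topological_ab_group_add) \<Rightarrow> ('a \<Rightarrow> real) \<Rightarrow> 'a \<Rightarrow> real" where
  "dpsi \<psi> U \<omega> = (THE D. has_dpsi \<psi> U D \<omega>)"

definition C2_psi :: "(real \<Rightarrow> 'a::topological_ab_group_add) \<Rightarrow> ('a \<Rightarrow> real) \<Rightarrow> bool" where
  "C2_psi \<psi> U \<longleftrightarrow> continuous_on UNIV U \<and>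
     (\<forall>\<omega>. \<exists>D. has_dpsi \<psi> U D \<omega>) \<and> continuous_on UNIV (dpsi \<psi> U) \<and>
     (\<forall>\<omega>. \<exists>D. has_dpsi \<psi> (dpsi \<psi> U) D \<omega>) \<and> continuous_on UNIV (dpsi \<psi> (dpsi \<psi> U))"

definition pp_tilde :: "(real \<Rightarrow> real) \<Rightarrow> real \<Rightarrow> real \<Rightarrow> real" where
  "pp_tilde p t0 v0 = (THE s. (s - t0) * v0 = p s)"

definition pp_map :: "(real \<Rightarrow> real) \<Rightarrow> real \<times> real \<Rightarrow> real \<times> real" where
  "pp_map p tv = (let t0 = fst tv; v0 = snd tv; s = pp_tilde p t0 v0;
                      v1 = v0 - 2 * deriv p s
                  in (s + p s / v1, v1))"

definition pp_orbit :: "(real \<Rightarrow> real) \<Rightarrow> real \<times> real \<Rightarrow> nat \<Rightarrow> real \<times> real" where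
  "pp_orbit p tv n = (pp_map p ^^ n) tv"

definition escaping_set :: "(real \<Rightarrow> real) \<Rightarrow> real \<Rightarrow> (real \<times> real) set" where
  "escaping_set p vs = {tv. snd tv > vs \<and> (\<forall>n. snd (pp_orbit p tv n) > vs) \<and>
      filterlim (\<lambda>n. snd (pp_orbit p tv n)) at_top sequentially}"

end

theory Submission
  imports Defs
begin

text \<open>
  Following the phase \<open>\<omega> + \<psi> t\<close> instead of the time \<open>t\<close> turns the ping-pong maps of all
  forcings into a single map of \<open>\<Omega> \<times> \<real>\<close>, and averaging along the flow shows that at high
  speed preimages have at most the \<open>v dv d\<mu>\<close>-measure of the set itself. The adiabatic invariant
  \<open>P \<omega> * v\<close> gains only \<open>o(1/v)\<close> per step, so an orbit on which it rises past a level \<open>c\<close> passes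
  through a set whose measure tends to \<open>0\<close> as \<open>c\<close> grows. The last visits of escaping orbits to a
  sublevel set of the invariant form a wandering set; each of its points later crosses every
  higher level, so it is null, and so is the set of escaping orbits that are fast from the start.
  By Fubini the latter is null along almost every flow line. For a single forcing the ping-pong map
  is a local diffeomorphism of the plane, so the remaining escaping orbits, which become fast only
  later, form a null set as well.
\<close>

section \<open>Escape under subinvariant maps\<close>

locale subinvariant_map =
  fixes M :: "'b measure" and F :: "'b \<Rightarrow> 'b" and E :: "'b set"
  assumes measurable_map [measurable]: "F \<in> M \<rightarrow>\<^sub>M M"
    and sets_domain [measurable]: "E \<in> sets M"
    and map_in_domain: "x \<in> E \<Longrightarrow> F x \<in> E"
    and emeasure_vimage_le:
      "B \<in> sets M \<Longrightarrow> B \<subseteq> E \<Longrightarrow> emeasure M (E \<inter> F -` B) \<le> emeasure M B"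
begin

lemma funpow_in_domain: "x \<in> E \<Longrightarrow> (F ^^ n) x \<in> E"
  by (induction n) (auto intro: map_in_domain)

lemma null_sets_funpow_vimage:
  assumes N: "N \<in> null_sets M"
  shows "{x \<in> E. (F ^^ n) x \<in> N} \<in> null_sets M"
proof (induction n)
  case 0
  have "E \<inter> N \<in> null_sets M" using N by (intro null_set_Int1 sets_domain)
  then show ?case by (simp add: Int_def)
next
  case (Suc n)
  let ?V = "{x \<in> E. (F ^^ n) x \<in> N}"
  have [measurable]: "N \<in> sets M" using N by auto
  have "{x \<in> E. (F ^^ Suc n) x \<in> N} = E \<inter> F -` ?V"
    by (auto simp: funpow_Suc_right intro: map_in_domain simp del: funpow.simps)
  moreover have "emeasure M (E \<inter> F -` ?V) = 0"
    using emeasure_vimage_le[of ?V] null_setsD1[OF Suc] null_setsD2[OF Suc] by auto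
  moreover have "{x \<in> E. (F ^^ Suc n) x \<in> N} \<in> sets M" by measurable
  ultimately show ?case by (intro null_setsI) simp_all
qed

definition hits_avoiding :: "'b set \<Rightarrow> 'b set \<Rightarrow> nat \<Rightarrow> 'b set" where
  "hits_avoiding B Z n = {x \<in> E. (F ^^ n) x \<in> B \<and> (\<forall>i<n. (F ^^ Suc i) x \<notin> Z)}"

lemma sets_hits_avoiding [measurable]:
  assumes [measurable]: "B \<in> sets M" "Z \<in> sets M"
  shows "hits_avoiding B Z n \<in> sets M"
  unfolding hits_avoiding_def by measurable

lemma hits_avoiding_Suc: "hits_avoiding B Z (Suc n) = E \<inter> F -` (hits_avoiding B Z n - Z)"
  by (auto simp: hits_avoiding_def All_less_Suc2 funpow_swap1 intro: map_in_domain)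

text \<open>The part of each set lying in \<open>Z\<close> is discarded before the next preimage is taken, so
  the discarded parts together have at most the measure of \<open>B\<close>.\<close>
lemma sum_emeasure_hits_avoiding_le:
  assumes [measurable]: "B \<in> sets M" "Z \<in> sets M"
  shows "(\<Sum>i<n. emeasure M (hits_avoiding B Z i \<inter> Z)) + emeasure M (hits_avoiding B Z n)
    \<le> emeasure M B"
proof (induction n)
  case 0
  show ?case by (auto simp: hits_avoiding_def intro: emeasure_mono)
next
  case (Suc n)
  let ?H = "hits_avoiding B Z"
  have "emeasure M (?H (Suc n)) \<le> emeasure M (?H n - Z)"
    unfolding hits_avoiding_Suc by (intro emeasure_vimage_le) (auto simp: hits_avoiding_def)
  moreover have "emeasure M (?H n) = emeasure M (?H n \<inter> Z) + emeasure M (?H n - Z)"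
    by (subst plus_emeasure) (auto intro!: arg_cong[where f="emeasure M"])
  ultimately have "(\<Sum>i<Suc n. emeasure M (?H i \<inter> Z)) + emeasure M (?H (Suc n))
      \<le> (\<Sum>i<n. emeasure M (?H i \<inter> Z)) + emeasure M (?H n)"
    by (simp add: add.assoc add_left_mono)
  with Suc show ?case by order
qed

lemma emeasure_wandering_le:
  assumes B[measurable]: "B \<in> sets M" and Z[measurable]: "Z \<in> sets M" "Z \<subseteq> E"
    and wandering: "\<And>x n. x \<in> Z \<Longrightarrow> n > 0 \<Longrightarrow> (F ^^ n) x \<notin> Z"
    and hits: "\<And>x. x \<in> Z \<Longrightarrow> \<exists>n. (F ^^ n) x \<in> B"
  shows "emeasure M Z \<le> emeasure M B"
proof -
  let ?H = "\<lambda>i. hits_avoiding B Z i \<inter> Z"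
  have "Z \<subseteq> (\<Union>i. ?H i)"
  proof
    fix x assume x: "x \<in> Z"
    then obtain n where "(F ^^ n) x \<in> B" using hits by blast
    with x Z(2) wandering[OF x zero_less_Suc] have "x \<in> ?H n" by (auto simp: hits_avoiding_def)
    then show "x \<in> (\<Union>i. ?H i)" by blast
  qed
  then have "emeasure M Z \<le> emeasure M (\<Union>i. ?H i)" by (intro emeasure_mono) auto
  also have "\<dots> \<le> (\<Sum>i. emeasure M (?H i))"
    by (intro emeasure_subadditive_countably) auto
  also have "\<dots> \<le> emeasure M B"
    using sum_emeasure_hits_avoiding_le[OF B Z(1)]
    by (intro suminf_le_const) (auto intro: order_trans[OF add_increasing2[OF zero_le order_refl]])
  finally show ?thesis .
qed

definition last_visit :: "('b \<Rightarrow> real) \<Rightarrow> real \<Rightarrow> 'b set" where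
  "last_visit W c = {x \<in> E. W x \<le> c \<and> (\<forall>n. c < W ((F ^^ Suc n) x))}"

lemma sets_last_visit [measurable]:
  assumes [measurable]: "W \<in> borel_measurable M"
  shows "last_visit W c \<in> sets M"
  unfolding last_visit_def by measurable

lemma funpow_in_last_visit:
  assumes x: "x \<in> E" "W x \<le> c"
    and escapes: "filterlim (\<lambda>n. W ((F ^^ n) x)) at_top sequentially"
  shows "\<exists>n. (F ^^ n) x \<in> last_visit W c"
proof -
  let ?L = "{n. W ((F ^^ n) x) \<le> c}"
  have "\<forall>\<^sub>F n in cofinite. c < W ((F ^^ n) x)"
    using escapes by (simp add: filterlim_at_top_dense cofinite_eq_sequentially)
  then have fin: "finite ?L" by (simp add: eventually_cofinite not_less)
  have "0 \<in> ?L" using x by simp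
  with fin have "Max ?L \<in> ?L" by (intro Max_in) blast+
  moreover have "c < W ((F ^^ (Suc n + Max ?L)) x)" for n
    using Max_ge[OF fin, of "Suc n + Max ?L"] by force
  ultimately have "(F ^^ Max ?L) x \<in> last_visit W c"
    unfolding last_visit_def using funpow_in_domain[OF x(1)]
    by (simp add: funpow_add[unfolded o_def, THEN fun_cong, symmetric] del: funpow.simps)
  then show ?thesis ..
qed

lemma emeasure_last_visit_mono:
  assumes [measurable]: "W \<in> borel_measurable M"
    and escapes: "\<And>x. x \<in> E \<Longrightarrow> filterlim (\<lambda>n. W ((F ^^ n) x)) at_top sequentially"
    and "c \<le> d"
  shows "emeasure M (last_visit W c) \<le> emeasure M (last_visit W d)"
proof (rule emeasure_wandering_le)
  show "(F ^^ n) x \<notin> last_visit W c" if x: "x \<in> last_visit W c" and "n > 0" for x n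
  proof -
    from \<open>n > 0\<close> obtain m where "n = Suc m" using gr0_implies_Suc by blast
    then have "c < W ((F ^^ n) x)" using x unfolding last_visit_def by blast
    then show ?thesis by (simp add: last_visit_def)
  qed
  show "\<exists>n. (F ^^ n) x \<in> last_visit W d" if "x \<in> last_visit W c" for x
    using that \<open>c \<le> d\<close> escapes by (intro funpow_in_last_visit) (auto simp: last_visit_def)
qed (auto simp: last_visit_def)

lemma null_sets_escaping_domain:
  fixes W :: "'b \<Rightarrow> real"
  assumes W[measurable]: "W \<in> borel_measurable M"
    and escapes: "\<And>x. x \<in> E \<Longrightarrow> filterlim (\<lambda>n. W ((F ^^ n) x)) at_top sequentially"
    and crossing: "\<And>e :: real. 0 < e \<Longrightarrow>
      \<exists>\<^sub>F c in at_top. emeasure M {x \<in> E. W x \<le> c \<and> c < W (F x)} \<le> ennreal e"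
  shows "E \<in> null_sets M"
proof -
  have "emeasure M (last_visit W c) \<le> 0 + ennreal e" if e: "0 < e" for c e :: real
  proof -
    obtain d where d: "c \<le> d" "emeasure M {x \<in> E. W x \<le> d \<and> d < W (F x)} \<le> ennreal e"
      using frequently_ex[OF frequently_eventually_frequently[OF crossing[OF e]
            eventually_ge_at_top[of c]]] by blast
    have "emeasure M (last_visit W c) \<le> emeasure M (last_visit W d)"
      using W escapes d(1) by (rule emeasure_last_visit_mono)
    also have "\<dots> \<le> emeasure M {x \<in> E. W x \<le> d \<and> d < W (F x)}"
      by (intro emeasure_mono) (auto simp: last_visit_def dest: spec[of _ 0])
    finally show ?thesis using d(2) by simp
  qed
  then have "last_visit W c \<in> null_sets M" for c
    by (intro null_setsI sets_last_visit W) (metis ennreal_le_epsilon le_zero_eq)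
  then have "(\<Union>k::nat. \<Union>n. {x \<in> E. (F ^^ n) x \<in> last_visit W k}) \<in> null_sets M"
    by (intro null_sets_UN null_sets_funpow_vimage)
  moreover have "E \<subseteq> (\<Union>k::nat. \<Union>n. {x \<in> E. (F ^^ n) x \<in> last_visit W k})"
  proof
    fix x assume x: "x \<in> E"
    obtain k :: nat where "W x \<le> k" using real_arch_simple by blast
    from funpow_in_last_visit[OF x this escapes[OF x]] x
    show "x \<in> (\<Union>k::nat. \<Union>n. {x \<in> E. (F ^^ n) x \<in> last_visit W k})" by blast
  qed
  ultimately show ?thesis using null_sets_subset sets_domain by blast
qed

end

section \<open>Integration along the flow\<close>

lemma borel_measurable_Caratheodory:
  fixes h :: "'b \<Rightarrow> 'c::{metric_space, second_countable_topology} \<Rightarrow> 'd::metric_space"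
  assumes h: "\<And>t. (\<lambda>x. h x t) \<in> borel_measurable M"
    and cont: "\<And>x. continuous_on UNIV (h x)"
    and g: "g \<in> borel_measurable M"
  shows "(\<lambda>x. h x (g x)) \<in> borel_measurable M"
proof -
  obtain G where simple: "\<And>i. simple_function M (G i)"
    and lim: "\<And>x. x \<in> space M \<Longrightarrow> (\<lambda>i. G i x) \<longlonglongrightarrow> g x"
    using borel_measurable_implies_sequence_metric[OF g] by metis
  show ?thesis
  proof (rule borel_measurable_LIMSEQ_metric)
    show "(\<lambda>x. h x (G i x)) \<in> borel_measurable M" for i
    proof (rule measurable_compose_countable'[OF h])
      show "countable (G i ` space M)"
        using simple simple_functionD(1) uncountable_infinite by blast
      show "G i \<in> M \<rightarrow>\<^sub>M count_space (G i ` space M)"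
        using simple[of i] by (auto simp: simple_function_def measurable_count_space_eq2)
    qed
    show "(\<lambda>i. h x (G i x)) \<longlonglongrightarrow> h x (g x)" if "x \<in> space M" for x
      by (intro continuous_on_tendsto_compose[OF cont lim[OF that]]) auto
  qed
qed

lemma nn_integral_substitution_bounded_displacement:
  fixes f :: "real \<Rightarrow> ennreal" and x y :: real
  assumes [measurable]: "f \<in> borel_measurable borel"
    and deriv: "\<And>t. (\<sigma> has_real_derivative \<sigma>' t) (at t)"
    and cont: "continuous_on UNIV \<sigma>'" and nonneg: "\<And>t. 0 \<le> \<sigma>' t"
    and displacement: "\<And>t. \<bar>\<sigma> t - t\<bar> \<le> K"
  shows "(\<integral>\<^sup>+t. f t * indicator {x..y} t \<partial>lborel)
    = (\<integral>\<^sup>+t. f (\<sigma> t) * indicator {x..y} (\<sigma> t) * ennreal (\<sigma>' t) \<partial>lborel)"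
proof -
  define u v where "u = min x y - K" and "v = max x y + K + 1"
  have "0 \<le> K" using displacement[of 0] by linarith
  then have "u < v" by (simp add: u_def v_def)
  have ends: "\<sigma> u \<le> x" "y \<le> \<sigma> v"
    using displacement[of u] displacement[of v] by (auto simp: u_def v_def)
  have window: "t \<in> {u..v}" if "\<sigma> t \<in> {x..y}" for t
    using that displacement[of t] by (auto simp: u_def v_def)
  have "(\<integral>\<^sup>+t. f t * indicator {x..y} t \<partial>lborel)
      = (\<integral>\<^sup>+t. f t * indicator {x..y} t * indicator {\<sigma> u..\<sigma> v} t \<partial>lborel)"
    using ends by (intro nn_integral_cong) (auto split: split_indicator)
  also have "\<dots> = (\<integral>\<^sup>+t. f (\<sigma> t) * indicator {x..y} (\<sigma> t) * ennreal (\<sigma>' t)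
      * indicator {u..v} t \<partial>lborel)"
    by (rule nn_integral_substitution_aux)
       (use deriv nonneg \<open>u < v\<close> continuous_on_subset[OF cont] in auto)
  also have "\<dots> = (\<integral>\<^sup>+t. f (\<sigma> t) * indicator {x..y} (\<sigma> t) * ennreal (\<sigma>' t) \<partial>lborel)"
    using window by (intro nn_integral_cong) (auto split: split_indicator)
  finally show ?thesis .
qed

lemma has_dpsi_dpsi:
  assumes "has_dpsi \<psi> U D \<omega>"
  shows "has_dpsi \<psi> U (dpsi \<psi> U \<omega>) \<omega>"
  unfolding dpsi_def using assms
  by (rule theI) (use assms in \<open>auto simp: has_dpsi_def intro: tendsto_unique[OF trivial_limit_at]\<close>)

lemma has_dpsi_divide:
  assumes "has_dpsi \<psi> U D \<omega>"
  shows "has_dpsi \<psi> (\<lambda>\<omega>. U \<omega> / c) (D / c) \<omega>"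
  using tendsto_divide[OF assms[unfolded has_dpsi_def] tendsto_const, of c]
  by (cases "c = 0") (simp_all add: has_dpsi_def diff_divide_distrib mult.commute)

locale compact_flow =
  fixes \<psi> :: "real \<Rightarrow> 'a::{topological_ab_group_add, metric_space}"
    and \<mu> :: "'a measure"
  assumes compact_Omega: "compact (UNIV :: 'a set)"
    and continuous_psi: "continuous_on UNIV \<psi>"
    and psi_add: "\<psi> (s + t) = \<psi> s + \<psi> t"
    and haar: "haar_prob \<mu>"
begin

lemma psi_0 [simp]: "\<psi> 0 = 0"
  using psi_add[of 0 0] by simp

lemma psi_minus: "\<psi> (- t) = - \<psi> t"
  using psi_add[of t "- t"] by (simp add: eq_neg_iff_add_eq_0 add.commute)

lemma flow_add: "\<omega> + \<psi> (s + t) = \<omega> + \<psi> s + \<psi> t"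
  by (simp add: psi_add add.assoc)

sublocale prob_space \<mu>
  using haar by (simp add: haar_prob_def)

lemma sets_mu [measurable_cong]: "sets \<mu> = sets borel"
  using haar by (simp add: haar_prob_def)

lemma space_mu [simp]: "space \<mu> = UNIV"
  using sets_eq_imp_space_eq[OF sets_mu] by simp

lemma continuous_on_psi [continuous_intros]:
  "continuous_on A f \<Longrightarrow> continuous_on A (\<lambda>x. \<psi> (f x))"
  using continuous_on_compose2[OF continuous_psi] by blast

lemma borel_measurable_translate [measurable]:
  "(\<lambda>\<omega>. \<omega> + c) \<in> borel_measurable (borel :: 'a measure)"
  by (intro borel_measurable_continuous_onI continuous_intros)

text \<open>The type of \<open>\<Omega>\<close> is not of class \<open>second_countable_topology\<close>, so
  joint measurability cannot be read off from continuity.\<close>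
lemma borel_measurable_flow [measurable]:
  assumes [measurable]: "f \<in> borel_measurable M" "g \<in> borel_measurable M"
  shows "(\<lambda>x. f x + \<psi> (g x)) \<in> borel_measurable M"
  by (rule borel_measurable_Caratheodory[OF _ _ assms(2)]) (measurable, intro continuous_intros)

lemma bounded_range_continuous:
  fixes f :: "'a \<Rightarrow> 'b::metric_space"
  shows "continuous_on UNIV f \<Longrightarrow> bounded (range f)"
  using compact_continuous_image[OF _ compact_Omega] by (rule compact_imp_bounded)

lemma nn_integral_translate:
  assumes [measurable]: "g \<in> borel_measurable borel"
  shows "(\<integral>\<^sup>+\<omega>. g (\<omega> + c) \<partial>\<mu>) = (\<integral>\<^sup>+\<omega>. g \<omega> \<partial>\<mu>)"
proof -
  have "distr \<mu> \<mu> (\<lambda>\<omega>. \<omega> + c) = \<mu>"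
  proof (rule measure_eqI)
    fix A assume "A \<in> sets (distr \<mu> \<mu> (\<lambda>\<omega>. \<omega> + c))"
    then have A[measurable]: "A \<in> sets borel" by (simp add: sets_mu)
    have "(\<lambda>\<omega>. \<omega> + c) -` A = (\<lambda>x. - c + x) ` A"
      by (auto simp: image_iff algebra_simps intro!: bexI[where x="_ + c"])
    then have "measure \<mu> ((\<lambda>\<omega>. \<omega> + c) -` A) = measure \<mu> A"
      using haar A unfolding haar_prob_def by metis
    then show "emeasure (distr \<mu> \<mu> (\<lambda>\<omega>. \<omega> + c)) A = emeasure \<mu> A"
      by (subst emeasure_distr) (auto simp: emeasure_eq_measure)
  qed simp
  then have "(\<integral>\<^sup>+\<omega>. g \<omega> \<partial>\<mu>) = (\<integral>\<^sup>+\<omega>. g \<omega> \<partial>distr \<mu> \<mu> (\<lambda>\<omega>. \<omega> + c))" by simp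
  also have "\<dots> = (\<integral>\<^sup>+\<omega>. g (\<omega> + c) \<partial>\<mu>)" by (rule nn_integral_distr) auto
  finally show ?thesis by simp
qed

lemma nn_integral_shear:
  fixes N :: "'c measure" and H :: "'a \<Rightarrow> 'c \<Rightarrow> ennreal"
  assumes "sigma_finite_measure N"
    and [measurable]: "\<tau> \<in> borel_measurable N"
    and H[measurable]: "(\<lambda>(\<omega>, y). H \<omega> y) \<in> borel_measurable (\<mu> \<Otimes>\<^sub>M N)"
  shows "(\<integral>\<^sup>+\<omega>. \<integral>\<^sup>+y. H (\<omega> + \<psi> (\<tau> y)) y \<partial>N \<partial>\<mu>) = (\<integral>\<^sup>+\<omega>. \<integral>\<^sup>+y. H \<omega> y \<partial>N \<partial>\<mu>)"
proof -
  interpret N: sigma_finite_measure N by fact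
  interpret pair_sigma_finite \<mu> N ..
  have "(\<lambda>(\<omega>, y). (\<omega> + \<psi> (\<tau> y), y)) \<in> \<mu> \<Otimes>\<^sub>M N \<rightarrow>\<^sub>M \<mu> \<Otimes>\<^sub>M N" by measurable
  from measurable_compose[OF this H]
  have [measurable]: "(\<lambda>(\<omega>, y). H (\<omega> + \<psi> (\<tau> y)) y) \<in> borel_measurable (\<mu> \<Otimes>\<^sub>M N)"
    by (simp add: case_prod_beta')
  have "(\<integral>\<^sup>+\<omega>. \<integral>\<^sup>+y. H (\<omega> + \<psi> (\<tau> y)) y \<partial>N \<partial>\<mu>) = (\<integral>\<^sup>+y. \<integral>\<^sup>+\<omega>. H (\<omega> + \<psi> (\<tau> y)) y \<partial>\<mu> \<partial>N)"
    by (rule Fubini'[symmetric]) measurable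
  also have "\<dots> = (\<integral>\<^sup>+y. \<integral>\<^sup>+\<omega>. H \<omega> y \<partial>\<mu> \<partial>N)"
    by (intro nn_integral_cong nn_integral_translate) measurable
  also have "\<dots> = (\<integral>\<^sup>+\<omega>. \<integral>\<^sup>+y. H \<omega> y \<partial>N \<partial>\<mu>)"
    by (rule Fubini') measurable
  finally show ?thesis .
qed

lemma has_dpsi_imp_deriv:
  assumes "has_dpsi \<psi> U D (\<omega> + \<psi> t)"
  shows "((\<lambda>t. U (\<omega> + \<psi> t)) has_real_derivative D) (at t)"
  using assms by (simp add: has_dpsi_def DERIV_def flow_add)

text \<open>Along a flow line \<open>\<omega> \<mapsto> \<omega> + \<psi> (s \<omega>)\<close> is the time change
  \<open>t \<mapsto> t + s (\<omega> + \<psi> t)\<close>; the substitution rule on the line is then averaged over \<open>\<omega>\<close>,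
  with the unit window \<open>{0..1}\<close> making the line integrals finite without changing the average.\<close>
lemma nn_integral_flow_time_change:
  fixes s s' :: "'a \<Rightarrow> real"
  assumes s: "\<And>\<omega>. has_dpsi \<psi> s (s' \<omega>) \<omega>"
    and cont: "continuous_on UNIV s" "continuous_on UNIV s'"
    and nonneg: "\<And>\<omega>. 0 \<le> 1 + s' \<omega>"
    and [measurable]: "g \<in> borel_measurable borel"
  shows "(\<integral>\<^sup>+\<omega>. g (\<omega> + \<psi> (s \<omega>)) * ennreal (1 + s' \<omega>) \<partial>\<mu>) = (\<integral>\<^sup>+\<omega>. g \<omega> \<partial>\<mu>)"
proof -
  have [measurable]: "s \<in> borel_measurable borel" "s' \<in> borel_measurable borel"
    using cont by (auto intro: borel_measurable_continuous_onI)
  obtain K where K: "\<And>\<omega>. \<bar>s \<omega>\<bar> \<le> K"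
    using bounded_range_continuous[OF cont(1)] by (auto simp: bounded_iff)
  define G where "G \<omega> = g (\<omega> + \<psi> (s \<omega>)) * ennreal (1 + s' \<omega>)" for \<omega>
  have [measurable]: "G \<in> borel_measurable borel" unfolding G_def by measurable
  let ?I = "indicator {0..1} :: real \<Rightarrow> ennreal"
  have line: "(\<integral>\<^sup>+t. g (\<omega> + \<psi> t) * ?I t \<partial>lborel)
      = (\<integral>\<^sup>+t. G (\<omega> + \<psi> t) * ?I (t + s (\<omega> + \<psi> t)) \<partial>lborel)" for \<omega>
  proof -
    have "(\<integral>\<^sup>+t. g (\<omega> + \<psi> t) * ?I t \<partial>lborel) = (\<integral>\<^sup>+t. g (\<omega> + \<psi> (t + s (\<omega> + \<psi> t)))
        * ?I (t + s (\<omega> + \<psi> t)) * ennreal (1 + s' (\<omega> + \<psi> t)) \<partial>lborel)"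
    proof (rule nn_integral_substitution_bounded_displacement)
      show "((\<lambda>t. t + s (\<omega> + \<psi> t)) has_real_derivative 1 + s' (\<omega> + \<psi> t)) (at t)" for t
        by (intro derivative_intros has_dpsi_imp_deriv s)
      show "continuous_on UNIV (\<lambda>t. 1 + s' (\<omega> + \<psi> t))"
        by (intro continuous_intros continuous_on_compose2[OF cont(2)]) auto
    qed (use K nonneg in auto)
    then show ?thesis by (simp add: G_def flow_add mult_ac)
  qed
  have unit: "(\<integral>\<^sup>+t. c * ?I (t + r) \<partial>lborel) = c" for c r
  proof -
    have "?I (t + r) = indicator {- r..1 - r} t" for t by (auto split: split_indicator)
    then show ?thesis by (simp add: nn_integral_cmult_indicator)
  qed
  have "(\<integral>\<^sup>+\<omega>. g \<omega> \<partial>\<mu>) = (\<integral>\<^sup>+\<omega>. \<integral>\<^sup>+t. g \<omega> * ?I t \<partial>lborel \<partial>\<mu>)"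
    using unit[of _ 0] by simp
  also have "\<dots> = (\<integral>\<^sup>+\<omega>. \<integral>\<^sup>+t. G (\<omega> + \<psi> t) * ?I (t + s (\<omega> + \<psi> t)) \<partial>lborel \<partial>\<mu>)"
    unfolding line[symmetric]
    by (rule nn_integral_shear[symmetric, where H="\<lambda>\<omega> t. g \<omega> * ?I t"]) (unfold_locales, measurable)
  also have "\<dots> = (\<integral>\<^sup>+\<omega>. \<integral>\<^sup>+t. G \<omega> * ?I (t + s \<omega>) \<partial>lborel \<partial>\<mu>)"
    by (rule nn_integral_shear[where H="\<lambda>\<omega> t. G \<omega> * ?I (t + s \<omega>)"]) (unfold_locales, measurable)
  also have "\<dots> = (\<integral>\<^sup>+\<omega>. G \<omega> \<partial>\<mu>)" by (simp only: unit)
  finally show ?thesis by (simp add: G_def)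
qed

lemma AE_null_sets_flow_line:
  fixes N :: "'c measure"
  assumes "sigma_finite_measure N" and A: "A \<in> null_sets (\<mu> \<Otimes>\<^sub>M N)"
  shows "AE \<omega> in \<mu>. {(t, y) \<in> space (lborel \<Otimes>\<^sub>M N). (\<omega> + \<psi> t, y) \<in> A} \<in> null_sets (lborel \<Otimes>\<^sub>M N)"
proof -
  interpret N: sigma_finite_measure N by fact
  interpret lborel_N: pair_sigma_finite lborel N ..
  let ?R = "lborel \<Otimes>\<^sub>M N"
  have [measurable]: "A \<in> sets (\<mu> \<Otimes>\<^sub>M N)" using A by auto
  have "(\<integral>\<^sup>+\<omega>. \<integral>\<^sup>+y. indicator A (\<omega>, y) \<partial>N \<partial>\<mu>) = emeasure (\<mu> \<Otimes>\<^sub>M N) A"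
    by (subst N.nn_integral_fst) simp_all
  also have "\<dots> = 0" using A by auto
  finally have "AE \<omega> in \<mu>. (\<integral>\<^sup>+y. indicator A (\<omega>, y) \<partial>N) = 0"
    by (subst (asm) nn_integral_0_iff_AE) measurable
  then have "AE \<omega> in \<mu>. (\<integral>\<^sup>+z. indicator A (\<omega>, snd z) \<partial>?R) = 0"
    by eventually_elim (subst N.nn_integral_fst[symmetric], simp_all)
  then have "(\<integral>\<^sup>+\<omega>. \<integral>\<^sup>+z. indicator A (\<omega>, snd z) \<partial>?R \<partial>\<mu>) = 0"
    by (subst nn_integral_0_iff_AE) simp_all
  then have "(\<integral>\<^sup>+\<omega>. \<integral>\<^sup>+z. indicator A (\<omega> + \<psi> (fst z), snd z) \<partial>?R \<partial>\<mu>) = 0"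
    by (subst nn_integral_shear[where H="\<lambda>\<omega> z. indicator A (\<omega>, snd z)"])
       (simp_all add: lborel_N.sigma_finite_measure_axioms)
  then have "AE \<omega> in \<mu>. (\<integral>\<^sup>+z. indicator A (\<omega> + \<psi> (fst z), snd z) \<partial>?R) = 0"
    by (subst (asm) nn_integral_0_iff_AE) simp_all
  then show ?thesis
  proof eventually_elim
    fix \<omega>
    assume zero: "(\<integral>\<^sup>+z. indicator A (\<omega> + \<psi> (fst z), snd z) \<partial>?R) = 0"
    let ?S = "{(t, y) \<in> space ?R. (\<omega> + \<psi> t, y) \<in> A}"
    have "{z \<in> space ?R. (\<omega> + \<psi> (fst z), snd z) \<in> A} \<in> sets ?R" by measurable
    then have S: "?S \<in> sets ?R" by (simp add: case_prod_beta')
    have "emeasure ?R ?S = (\<integral>\<^sup>+z. indicator A (\<omega> + \<psi> (fst z), snd z) \<partial>?R)"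
      unfolding nn_integral_indicator[OF S, symmetric]
      by (intro nn_integral_cong) (auto split: split_indicator)
    with S zero show "?S \<in> null_sets ?R" by auto
  qed
qed

lemma uniform_limit_flow:
  fixes U :: "'a \<Rightarrow> 'b::metric_space"
  assumes "continuous_on UNIV U"
  shows "uniform_limit UNIV (\<lambda>t \<omega>. U (\<omega> + \<psi> t)) U (nhds 0)"
proof (rule uniform_limitI)
  fix e :: real assume "0 < e"
  have "uniformly_continuous_on (UNIV \<times> {-1..1}) (\<lambda>x. U (fst x + \<psi> (snd x)))"
    by (intro compact_uniformly_continuous compact_Times compact_Omega
          continuous_on_compose2[OF assms] continuous_intros) auto
  then obtain d where d: "0 < d" "\<And>x y. x \<in> UNIV \<times> {-1..1} \<Longrightarrow> y \<in> UNIV \<times> {-1..1} \<Longrightarrow> dist y x < d \<Longrightarrow>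
      dist (U (fst y + \<psi> (snd y))) (U (fst x + \<psi> (snd x))) < e"
    unfolding uniformly_continuous_on_def using \<open>0 < e\<close> by meson
  have "dist (U (\<omega> + \<psi> t)) (U \<omega>) < e" if "dist t 0 < min 1 d" for \<omega> t
    using d(2)[of "(\<omega>, 0)" "(\<omega>, t)"] that by (auto simp: dist_Pair_Pair abs_less_iff)
  then show "\<forall>\<^sub>F t in nhds 0. \<forall>\<omega>\<in>UNIV. dist (U (\<omega> + \<psi> t)) (U \<omega>) < e"
    unfolding eventually_nhds_metric using d(1) by (intro exI[of _ "min 1 d"]) auto
qed

lemma flow_Taylor:
  assumes U: "C2_psi \<psi> U"
  shows "\<exists>\<xi>. \<bar>\<xi>\<bar> \<le> \<bar>h\<bar> \<and>
    U (\<omega> + \<psi> h) = U \<omega> + dpsi \<psi> U \<omega> * h + dpsi \<psi> (dpsi \<psi> U) (\<omega> + \<psi> \<xi>) / 2 * h\<^sup>2"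
proof (cases "h = 0")
  case False
  define D where "D m t = (if m = 0 then U (\<omega> + \<psi> t) else if m = 1 then dpsi \<psi> U (\<omega> + \<psi> t)
    else dpsi \<psi> (dpsi \<psi> U) (\<omega> + \<psi> t))" for m :: nat and t
  have "\<exists>t. (if h < 0 then h < t \<and> t < 0 else 0 < t \<and> t < h) \<and>
      D 0 h = (\<Sum>m<2. D m 0 / fact m * (h - 0) ^ m) + D 2 t / fact 2 * (h - 0) ^ 2"
  proof (rule Taylor[where a="- \<bar>h\<bar>" and b="\<bar>h\<bar>"])
    show "\<forall>m t. m < 2 \<and> - \<bar>h\<bar> \<le> t \<and> t \<le> \<bar>h\<bar> \<longrightarrow> (D m has_real_derivative D (Suc m) t) (at t)"
      using U by (auto simp: D_def[abs_def] less_2_cases_iff C2_psi_def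
          intro!: has_dpsi_imp_deriv intro: has_dpsi_dpsi)
  qed (use False in auto)
  then obtain t where "if h < 0 then h < t \<and> t < 0 else 0 < t \<and> t < h"
      "D 0 h = (\<Sum>m<2. D m 0 / fact m * h ^ m) + D 2 t / fact 2 * h ^ 2"
    by auto
  then show ?thesis by (intro exI[of _ t]) (auto simp: D_def numeral_2_eq_2 split: if_splits)
qed simp

lemma flow_Taylor_uniform:
  assumes U: "C2_psi \<psi> U" and "0 < e"
  shows "\<forall>\<^sub>F h in nhds 0. \<forall>\<omega>.
    \<bar>U (\<omega> + \<psi> h) - (U \<omega> + dpsi \<psi> U \<omega> * h + dpsi \<psi> (dpsi \<psi> U) \<omega> / 2 * h\<^sup>2)\<bar> \<le> e * h\<^sup>2"
proof -
  let ?D = "dpsi \<psi> (dpsi \<psi> U)"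
  have "continuous_on UNIV ?D" using U by (simp add: C2_psi_def)
  from uniform_limitD[OF uniform_limit_flow[OF this] \<open>0 < e\<close>]
  obtain d where d: "0 < d" "\<And>t \<omega>. \<bar>t\<bar> < d \<Longrightarrow> \<bar>?D (\<omega> + \<psi> t) - ?D \<omega>\<bar> < e"
    by (auto simp: eventually_nhds_metric dist_real_def)
  have "\<bar>U (\<omega> + \<psi> h) - (U \<omega> + dpsi \<psi> U \<omega> * h + ?D \<omega> / 2 * h\<^sup>2)\<bar> \<le> e * h\<^sup>2" if h: "\<bar>h\<bar> < d" for h \<omega>
  proof -
    obtain \<xi> where "\<bar>\<xi>\<bar> \<le> \<bar>h\<bar>"
      and "U (\<omega> + \<psi> h) = U \<omega> + dpsi \<psi> U \<omega> * h + ?D (\<omega> + \<psi> \<xi>) / 2 * h\<^sup>2"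
      using flow_Taylor[OF U] by blast
    then have "U (\<omega> + \<psi> h) - (U \<omega> + dpsi \<psi> U \<omega> * h + ?D \<omega> / 2 * h\<^sup>2)
        = (?D (\<omega> + \<psi> \<xi>) - ?D \<omega>) / 2 * h\<^sup>2"
      and "\<bar>(?D (\<omega> + \<psi> \<xi>) - ?D \<omega>) / 2\<bar> \<le> e"
      using d(2)[of \<xi> \<omega>] h by (auto simp: algebra_simps diff_divide_distrib)
    then show ?thesis by (simp only: abs_mult abs_power2 mult_right_mono zero_le_power2)
  qed
  then show ?thesis using d(1) by (auto simp: eventually_nhds_metric dist_real_def)
qed

end

section \<open>The ping-pong map of a single forcing\<close>

lemma has_derivative_compose_fst:
  assumes "\<And>t. (f has_real_derivative f' t) (at t)"
  shows "((\<lambda>z. f (fst z)) has_derivative (\<lambda>h. f' (fst z) * fst h)) (at (z :: real \<times> real))"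
  by (rule has_derivative_compose[OF has_derivative_fst[OF has_derivative_ident]
        assms[unfolded has_field_derivative_def]])

locale ping_pong_forcing =
  fixes p p' p'' :: "real \<Rightarrow> real" and b v_star :: real
  assumes p_deriv: "(p has_real_derivative p' t) (at t)"
    and p'_deriv: "(p' has_real_derivative p'' t) (at t)"
    and p_pos: "0 < p t" and p_le: "p t \<le> b"
    and v_star_nonneg: "0 \<le> v_star" and two_p'_le: "2 * p' t \<le> v_star"
begin

lemma p'_less: "v_star < v \<Longrightarrow> p' t < v"
  using two_p'_le[of t] v_star_nonneg by linarith

lemma strict_mono_wall_gap:
  assumes "v_star < v"
  shows "strict_mono (\<lambda>s. s * v - p s)"
proof (rule strict_monoI)
  fix s t :: real assume "s < t"
  show "s * v - p s < t * v - p t"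
  proof (rule DERIV_pos_imp_increasing[OF \<open>s < t\<close>])
    fix x
    have "((\<lambda>s. s * v - p s) has_real_derivative v - p' x) (at x)"
      by (auto intro!: derivative_eq_intros p_deriv)
    then show "\<exists>y. ((\<lambda>s. s * v - p s) has_real_derivative y) (at x) \<and> 0 < y"
      using p'_less[OF assms, of x] by (intro exI[of _ "v - p' x"]) simp
  qed
qed

lemma pp_tilde_eqI:
  assumes "v_star < v" and s: "(s - t) * v = p s"
  shows "pp_tilde p t v = s"
  unfolding pp_tilde_def
proof (rule the_equality, rule s)
  fix u assume "(u - t) * v = p u"
  with s have "u * v - p u = s * v - p s" by (simp add: algebra_simps)
  then show "u = s" by (simp only: strict_mono_eq[OF strict_mono_wall_gap[OF assms(1)]])
qed

lemma pp_tilde_eq: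
  assumes "v_star < v"
  shows "(pp_tilde p t v - t) * v = p (pp_tilde p t v)"
proof -
  have v: "0 < v" using assms v_star_nonneg by simp
  have "\<exists>s\<ge>t. s \<le> t + b / v \<and> (s - t) * v - p s = 0"
  proof (rule IVT')
    show "(t - t) * v - p t \<le> 0" using p_pos[of t] by simp
    show "0 \<le> (t + b / v - t) * v - p (t + b / v)" using p_le v by simp
    have "0 < b" using p_pos p_le by (rule less_le_trans)
    then show "t \<le> t + b / v" using v by simp
    show "continuous_on {t..t + b / v} (\<lambda>s. (s - t) * v - p s)"
      by (intro continuous_intros DERIV_continuous_on[OF DERIV_subset[OF p_deriv]]) auto
  qed
  then obtain s where "(s - t) * v = p s" by auto
  with pp_tilde_eqI[OF assms this] show ?thesis by simp
qed

lemma pp_tilde_le_iff: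
  assumes "v_star < v"
  shows "pp_tilde p t v \<le> s \<longleftrightarrow> p s \<le> (s - t) * v"
  using strict_mono_less_eq[OF strict_mono_wall_gap[OF assms], of "pp_tilde p t v" s]
    pp_tilde_eq[OF assms, of t] by (auto simp: algebra_simps)

definition launch :: "real \<times> real \<Rightarrow> real \<times> real" where
  "launch z = (fst z - p (fst z) / snd z, snd z)"

definition bounce :: "real \<times> real \<Rightarrow> real \<times> real" where
  "bounce z = (fst z + p (fst z) / (snd z - 2 * p' (fst z)), snd z - 2 * p' (fst z))"

lemma launch_pp_tilde: "v_star < v \<Longrightarrow> launch (pp_tilde p t v, v) = (t, v)"
  using pp_tilde_eq[of v t] v_star_nonneg by (simp add: launch_def field_simps)

lemma pp_map_eq_bounce: "pp_map p y = bounce (pp_tilde p (fst y) (snd y), snd y)"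
  by (simp add: pp_map_def bounce_def Let_def DERIV_imp_deriv[OF p_deriv])

definition bounce_speed_deriv :: "real \<times> real \<Rightarrow> real \<times> real \<Rightarrow> real" where
  "bounce_speed_deriv z h = snd h - 2 * (p'' (fst z) * fst h)"

definition bounce_deriv :: "real \<times> real \<Rightarrow> real \<times> real \<Rightarrow> real \<times> real" where
  "bounce_deriv z h = (fst h
      + (p' (fst z) * fst h * snd (bounce z) - p (fst z) * bounce_speed_deriv z h)
        / (snd (bounce z) * snd (bounce z)),
    bounce_speed_deriv z h)"

lemma has_derivative_bounce:
  assumes "snd (bounce z) \<noteq> 0"
  shows "(bounce has_derivative bounce_deriv z) (at z)"
proof -
  have speed: "((\<lambda>z. snd (bounce z)) has_derivative bounce_speed_deriv z) (at z)"
    unfolding bounce_def snd_conv bounce_speed_deriv_def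
    by (intro derivative_intros has_derivative_compose_fst p'_deriv)
  have "((\<lambda>z. (fst z + p (fst z) / snd (bounce z), snd (bounce z)))
      has_derivative bounce_deriv z) (at z)"
    unfolding bounce_deriv_def using assms
    by (intro has_derivative_Pair has_derivative_add has_derivative_divide' speed
        has_derivative_fst[OF has_derivative_ident] has_derivative_compose_fst p_deriv)
  then show ?thesis by (simp add: bounce_def[abs_def])
qed

lemma inj_bounce_deriv:
  assumes "v_star < snd z" and return: "0 < snd (bounce z)"
  shows "inj (bounce_deriv z)"
proof -
  have "linear (bounce_deriv z)"
    using return by (intro has_derivative_linear[OF has_derivative_bounce]) simp
  moreover have "h = 0" if "bounce_deriv z h = 0" for h
  proof -
    let ?u = "snd (bounce z)"
    from that have speed: "bounce_speed_deriv z h = 0" and "fst h + p' (fst z) * fst h / ?u = 0"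
      using return by (auto simp: bounce_deriv_def zero_prod_def)
    then have "(?u + p' (fst z)) * fst h = 0" using return by (simp add: field_simps)
    moreover have "0 < ?u + p' (fst z)"
      using p'_less[OF assms(1), of "fst z"] by (simp add: bounce_def)
    ultimately show "h = 0" using speed by (simp add: bounce_speed_deriv_def prod_eq_iff)
  qed
  ultimately show ?thesis using linear_injective_0 by blast
qed

lemma negligible_bounce_vimage:
  assumes "negligible N"
  shows "negligible {z. v_star < snd z \<and> v_star < snd (bounce z) \<and> bounce z \<in> N}"
proof -
  have "negligible {z \<in> {z. v_star < snd z \<and> v_star < snd (bounce z)}. bounce z \<in> N}"
    using v_star_nonneg
    by (intro negligible_differentiable_vimage[where f'=bounce_deriv] assms)
      (auto intro!: inj_bounce_deriv has_derivative_at_withinI has_derivative_bounce)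
  then show ?thesis by (simp add: conj_assoc)
qed

text \<open>Since \<open>launch\<close> inverts the outward flight, preimages under the latter are images of a
  differentiable map, and no derivative of \<open>pp_tilde\<close> is needed.\<close>
lemma negligible_pp_map_vimage:
  assumes "negligible N"
  shows "negligible {y. v_star < snd y \<and> v_star < snd (pp_map p y) \<and> pp_map p y \<in> N}"
proof -
  let ?S = "{z. v_star < snd z \<and> v_star < snd (bounce z) \<and> bounce z \<in> N}"
  have "launch differentiable_on ?S"
    using v_star_nonneg unfolding launch_def[abs_def]
    by (auto intro!: differentiable_at_imp_differentiable_on derivative_intros
        differentiableI[OF has_derivative_compose_fst[OF p_deriv]]
        linear_imp_differentiable[OF linear_fst]
        linear_imp_differentiable[OF linear_snd])
  then have "negligible (launch ` ?S)"
    using negligible_bounce_vimage[OF assms]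
    by (intro negligible_differentiable_image_negligible) auto
  moreover have "{y. v_star < snd y \<and> v_star < snd (pp_map p y) \<and> pp_map p y \<in> N} \<subseteq> launch ` ?S"
  proof
    fix y assume y: "y \<in> {y. v_star < snd y \<and> v_star < snd (pp_map p y) \<and> pp_map p y \<in> N}"
    define z where "z = (pp_tilde p (fst y) (snd y), snd y)"
    have "z \<in> ?S" using y by (simp add: pp_map_eq_bounce z_def)
    moreover have "launch z = y"
      using y launch_pp_tilde[of "snd y" "fst y"] by (simp add: z_def)
    ultimately show "y \<in> launch ` ?S" by blast
  qed
  ultimately show ?thesis by (rule negligible_subset)
qed

lemma negligible_pp_orbit_vimage:
  assumes "negligible N"
  shows "negligible {y. (\<forall>i\<le>n. v_star < snd (pp_orbit p y i)) \<and> pp_orbit p y n \<in> N}"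
proof (induction n)
  case 0
  show ?case by (rule negligible_subset[OF assms]) (auto simp: pp_orbit_def)
next
  case (Suc n)
  have "pp_orbit p y (Suc i) = pp_orbit p (pp_map p y) i" for y i
    by (simp add: pp_orbit_def funpow_swap1)
  then show ?case
    by (intro negligible_subset[OF negligible_pp_map_vimage[OF Suc]])
      (auto simp: All_less_Suc2 less_Suc_eq_le[symmetric] pp_orbit_def[of _ _ 0])
qed

lemma negligible_escaping_set:
  assumes "negligible (escaping_set p c)"
  shows "negligible (escaping_set p v_star)"
proof (rule negligible_subset)
  let ?pull = "\<lambda>n. {y. (\<forall>i\<le>n. v_star < snd (pp_orbit p y i)) \<and> pp_orbit p y n \<in> escaping_set p c}"
  show "negligible (\<Union>n. ?pull n)"
    by (intro negligible_Union_nat negligible_pp_orbit_vimage assms)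
  show "escaping_set p v_star \<subseteq> (\<Union>n. ?pull n)"
  proof
    fix y assume y: "y \<in> escaping_set p v_star"
    then have lim: "filterlim (\<lambda>n. snd (pp_orbit p y n)) at_top sequentially"
      by (simp add: escaping_set_def)
    then obtain n where n: "\<And>i. n \<le> i \<Longrightarrow> c < snd (pp_orbit p y i)"
      by (auto simp: filterlim_at_top_dense eventually_sequentially)
    have shift: "pp_orbit p (pp_orbit p y n) i = pp_orbit p y (i + n)" for i
      by (simp add: pp_orbit_def funpow_add)
    have "pp_orbit p y n \<in> escaping_set p c"
      using n filterlim_compose[OF lim filterlim_add_const_nat_at_top[of n]]
      by (simp add: escaping_set_def shift)
    then show "y \<in> (\<Union>n. ?pull n)" using y by (auto simp: escaping_set_def)
  qed
qed

end

section \<open>The ping-pong map on phase space\<close>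

locale ping_pong = compact_flow \<psi> \<mu>
  for \<psi> :: "real \<Rightarrow> 'a::{topological_ab_group_add, metric_space}" and \<mu> +
  fixes P :: "'a \<Rightarrow> real" and a b :: real
  assumes a_pos: "0 < a"
    and P_C2: "C2_psi \<psi> P"
    and P_bounds: "a \<le> P \<omega> \<and> P \<omega> \<le> b"
begin

abbreviation P' :: "'a \<Rightarrow> real" where "P' \<equiv> dpsi \<psi> P"
abbreviation P'' :: "'a \<Rightarrow> real" where "P'' \<equiv> dpsi \<psi> P'"
abbreviation forcing :: "'a \<Rightarrow> real \<Rightarrow> real" where "forcing \<omega> \<equiv> \<lambda>t. P (\<omega> + \<psi> t)"
abbreviation phase_space :: "('a \<times> real) measure" where "phase_space \<equiv> \<mu> \<Otimes>\<^sub>M lborel"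

definition v_star :: real where "v_star = 2 * max (Sup (range P')) 0"

text \<open>Above this speed both flights are monotone time changes of every flow line.\<close>
definition fast_speed :: real where "fast_speed = 2 * (SUP \<omega>. \<bar>P' \<omega>\<bar>)"

sublocale phase_space: pair_sigma_finite \<mu> "lborel :: real measure" ..

lemma space_phase_space [simp]: "space phase_space = UNIV"
  by (simp add: space_pair_measure)

lemma continuous_P: "continuous_on UNIV P" and continuous_P': "continuous_on UNIV P'"
  and continuous_P'': "continuous_on UNIV P''"
  using P_C2 by (auto simp: C2_psi_def)

lemma measurable_P [measurable]: "P \<in> borel_measurable borel"
  and measurable_P' [measurable]: "P' \<in> borel_measurable borel"
  using continuous_P continuous_P' by (auto intro: borel_measurable_continuous_onI)

lemma P_pos: "0 < P \<omega>" and P_le: "P \<omega> \<le> b" and P_ge: "a \<le> P \<omega>"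
  using P_bounds[of \<omega>] a_pos by auto

lemma b_pos: "0 < b"
  using P_pos P_le by (rule less_le_trans)

lemma has_dpsi_P: "has_dpsi \<psi> P (P' \<omega>) \<omega>" and has_dpsi_P': "has_dpsi \<psi> P' (P'' \<omega>) \<omega>"
  using P_C2 by (auto simp: C2_psi_def intro: has_dpsi_dpsi)

lemma two_abs_P'_le: "2 * \<bar>P' \<omega>\<bar> \<le> fast_speed"
proof -
  have "bdd_above (range (\<lambda>\<omega>. \<bar>P' \<omega>\<bar>))"
    using continuous_P' by (intro bounded_imp_bdd_above bounded_range_continuous continuous_intros)
  then show ?thesis unfolding fast_speed_def by (intro mult_left_mono cSUP_upper) auto
qed

lemma fast_speed_nonneg: "0 \<le> fast_speed"
  using two_abs_P'_le[of 0] by linarith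

lemma v_star_nonneg: "0 \<le> v_star"
  by (simp add: v_star_def)

lemma two_P'_le_v_star: "2 * P' \<omega> \<le> v_star"
proof -
  have "P' \<omega> \<le> Sup (range P')"
    using bounded_imp_bdd_above[OF bounded_range_continuous[OF continuous_P']]
    by (intro cSup_upper) auto
  then show ?thesis by (simp add: v_star_def)
qed

lemma v_star_le_fast_speed: "v_star \<le> fast_speed"
proof -
  have "P' \<omega> \<le> fast_speed / 2" for \<omega> using two_abs_P'_le[of \<omega>] by linarith
  then have "Sup (range P') \<le> fast_speed / 2" by (intro cSup_least) auto
  then show ?thesis using fast_speed_nonneg by (simp add: v_star_def)
qed

sublocale flow_line: ping_pong_forcing "forcing \<omega>" "\<lambda>t. P' (\<omega> + \<psi> t)" "\<lambda>t. P'' (\<omega> + \<psi> t)" b v_star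
  for \<omega>
  by unfold_locales
    (rule has_dpsi_imp_deriv has_dpsi_P has_dpsi_P' P_pos P_le v_star_nonneg two_P'_le_v_star)+

definition wall_phase :: "'a \<Rightarrow> real \<Rightarrow> 'a" where
  "wall_phase \<omega> v = \<omega> + \<psi> (pp_tilde (forcing \<omega>) 0 v)"

definition launch :: "'a \<Rightarrow> real \<Rightarrow> 'a" where
  "launch \<omega> v = \<omega> + \<psi> (- (P \<omega> / v))"

definition rebound :: "'a \<Rightarrow> real \<Rightarrow> 'a \<times> real" where
  "rebound \<omega> v = (\<omega> + \<psi> (P \<omega> / (v - 2 * P' \<omega>)), v - 2 * P' \<omega>)"

text \<open>At speeds up to \<open>v_star\<close>, \<open>pp_tilde\<close> may be unspecified; the identity keeps the
  map measurable.\<close>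
definition pp_step :: "'a \<times> real \<Rightarrow> 'a \<times> real" where
  "pp_step x = (if v_star < snd x then rebound (wall_phase (fst x) (snd x)) (snd x) else x)"

lemma wall_phase_launch:
  assumes "v_star < v"
  shows "wall_phase (launch \<omega> v) v = \<omega>"
proof -
  have "pp_tilde (forcing (launch \<omega> v)) 0 v = P \<omega> / v"
    using assms v_star_nonneg by (intro flow_line.pp_tilde_eqI) (simp_all add: launch_def psi_minus)
  then show ?thesis by (simp add: wall_phase_def) (simp add: launch_def psi_minus)
qed

lemma launch_wall_phase:
  assumes "v_star < v"
  shows "launch (wall_phase \<omega> v) v = \<omega>"
proof -
  have "P (wall_phase \<omega> v) / v = pp_tilde (forcing \<omega>) 0 v"
    using flow_line.pp_tilde_eq[OF assms, of \<omega> 0] assms v_star_nonneg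
    by (simp add: wall_phase_def field_simps)
  then show ?thesis by (simp add: launch_def psi_minus) (simp add: wall_phase_def)
qed

lemma pp_step_launch:
  "v_star < v \<Longrightarrow> pp_step (launch \<omega> v, v) = rebound \<omega> v"
  by (simp add: pp_step_def wall_phase_launch)

lemma pp_step_pp_map:
  assumes "v_star < snd y"
  shows "pp_step (\<omega> + \<psi> (fst y), snd y)
    = (\<omega> + \<psi> (fst (pp_map (forcing \<omega>) y)), snd (pp_map (forcing \<omega>) y))"
proof -
  let ?s = "pp_tilde (forcing \<omega>) (fst y) (snd y)"
  have "pp_tilde (forcing (\<omega> + \<psi> (fst y))) 0 (snd y) = ?s - fst y"
    using flow_line.pp_tilde_eq[OF assms, of \<omega> "fst y"] assms
    by (intro flow_line.pp_tilde_eqI) (simp_all flip: flow_add)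
  then have "wall_phase (\<omega> + \<psi> (fst y)) (snd y) = \<omega> + \<psi> ?s"
    by (simp add: wall_phase_def flip: flow_add)
  then show ?thesis
    using assms
    by (simp add: pp_step_def rebound_def flow_line.pp_map_eq_bounce flow_line.bounce_def flow_add)
qed

lemma snd_pp_step_bounds:
  assumes "fast_speed < snd x"
  shows "0 < snd (pp_step x)" "snd (pp_step x) \<le> 2 * snd x"
  using assms v_star_le_fast_speed fast_speed_nonneg two_abs_P'_le[of "wall_phase (fst x) (snd x)"]
  by (simp_all add: pp_step_def rebound_def abs_if split: if_splits)

lemma measurable_pp_tilde [measurable]:
  "(\<lambda>x. if v_star < snd x then pp_tilde (forcing (fst x)) 0 (snd x) else 0)
    \<in> borel_measurable phase_space"
  (is "?f \<in> _")
proof (subst borel_measurable_iff_le, intro allI)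
  fix c
  have "{x \<in> space phase_space. ?f x \<le> c} = {x \<in> space phase_space.
      (v_star < snd x \<and> P (fst x + \<psi> c) \<le> (c - 0) * snd x) \<or> (\<not> v_star < snd x \<and> 0 \<le> c)}"
    using flow_line.pp_tilde_le_iff by auto
  also have "\<dots> \<in> sets phase_space" by measurable
  finally show "{x \<in> space phase_space. ?f x \<le> c} \<in> sets phase_space" .
qed

lemma measurable_rebound [measurable]:
  assumes [measurable]: "f \<in> borel_measurable M" "g \<in> borel_measurable M"
  shows "(\<lambda>x. rebound (f x) (g x)) \<in> M \<rightarrow>\<^sub>M phase_space"
  unfolding rebound_def by measurable

lemma measurable_pp_step [measurable]: "pp_step \<in> phase_space \<rightarrow>\<^sub>M phase_space"
proof -
  let ?w = "\<lambda>x. fst x + \<psi> (if v_star < snd x then pp_tilde (forcing (fst x)) 0 (snd x) else 0)"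
  have "(\<lambda>x. if v_star < snd x then rebound (?w x) (snd x) else x) \<in> phase_space \<rightarrow>\<^sub>M phase_space"
    by measurable
  then show ?thesis
    by (rule back_subst[where P="\<lambda>f. f \<in> _"]) (auto simp: pp_step_def wall_phase_def fun_eq_iff)
qed

section \<open>Invariance of the Liouville measure\<close>

definition liouville :: "('a \<times> real) measure" where
  "liouville = density phase_space (\<lambda>x. ennreal (snd x))"

lemma sets_liouville [measurable_cong, simp]: "sets liouville = sets phase_space"
  by (simp add: liouville_def)

lemma emeasure_liouville:
  assumes [measurable]: "B \<in> sets phase_space"
  shows "emeasure liouville B = (\<integral>\<^sup>+v. \<integral>\<^sup>+\<omega>. ennreal v * indicator B (\<omega>, v) \<partial>\<mu> \<partial>lborel)"
proof -
  have "emeasure liouville B = (\<integral>\<^sup>+x. ennreal (snd x) * indicator B x \<partial>phase_space)"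
    unfolding liouville_def by (rule emeasure_density) measurable
  also have "\<dots> = (\<integral>\<^sup>+v. \<integral>\<^sup>+\<omega>. ennreal v * indicator B (\<omega>, v) \<partial>\<mu> \<partial>lborel)"
    by (subst phase_space.nn_integral_snd[symmetric]) simp_all
  finally show ?thesis .
qed

lemma null_sets_liouville_imp_null_sets:
  assumes B: "B \<in> null_sets liouville" and pos: "\<And>x. x \<in> B \<Longrightarrow> 0 < snd x"
  shows "B \<in> null_sets phase_space"
proof -
  have B_sets: "B \<in> sets phase_space" using B by auto
  have "(\<lambda>x. ennreal (snd x)) \<in> borel_measurable phase_space" by measurable
  with B have "AE x in phase_space. x \<in> B \<longrightarrow> ennreal (snd x) = 0"
    by (simp add: liouville_def null_sets_density_iff)
  then have "AE x in phase_space. x \<notin> B"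
    by eventually_elim (use pos in \<open>force simp: ennreal_eq_0_iff\<close>)
  with B_sets show ?thesis by (simp only: AE_iff_null_sets)
qed

lemma nn_integral_drift:
  assumes v: "fast_speed < 2 * \<bar>v\<bar>" and [measurable]: "g \<in> borel_measurable borel"
  shows "(\<integral>\<^sup>+\<omega>. g (\<omega> + \<psi> (P \<omega> / v)) * ennreal (1 + P' \<omega> / v) \<partial>\<mu>) = (\<integral>\<^sup>+\<omega>. g \<omega> \<partial>\<mu>)"
proof (rule nn_integral_flow_time_change)
  show "has_dpsi \<psi> (\<lambda>\<omega>. P \<omega> / v) (P' \<omega> / v) \<omega>" for \<omega>
    by (rule has_dpsi_divide[OF has_dpsi_P])
  show "0 \<le> 1 + P' \<omega> / v" for \<omega>
  proof -
    have "\<bar>P' \<omega> / v\<bar> \<le> 1" using v two_abs_P'_le[of \<omega>] by (simp add: abs_divide divide_le_eq)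
    then show ?thesis by linarith
  qed
  have "v \<noteq> 0" using v fast_speed_nonneg by auto
  then show "continuous_on UNIV (\<lambda>\<omega>. P \<omega> / v)" "continuous_on UNIV (\<lambda>\<omega>. P' \<omega> / v)"
    by (auto intro!: continuous_intros continuous_P continuous_P')
qed measurable

text \<open>Parametrised by the phase at the moving wall, the outward flight is the drift with
  velocity \<open>- v\<close> run backwards, so both flights are covered by the same change of variables.\<close>
lemma nn_integral_pp_step:
  assumes v: "fast_speed < v" and [measurable]: "g \<in> borel_measurable phase_space"
  shows "(\<integral>\<^sup>+\<omega>. ennreal v * g (pp_step (\<omega>, v)) \<partial>\<mu>)
    = (\<integral>\<^sup>+\<omega>. ennreal (v - P' \<omega>) * g (rebound \<omega> v) \<partial>\<mu>)"
proof -
  have pos: "0 < v" "v_star < v" using v fast_speed_nonneg v_star_le_fast_speed by auto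
  let ?G = "\<lambda>\<omega>. ennreal v * g (pp_step (\<omega>, v))"
  have "(\<integral>\<^sup>+\<omega>. ?G \<omega> \<partial>\<mu>) = (\<integral>\<^sup>+\<omega>. ?G (\<omega> + \<psi> (P \<omega> / (- v))) * ennreal (1 + P' \<omega> / (- v)) \<partial>\<mu>)"
    using v pos by (intro nn_integral_drift[symmetric]) (simp, measurable)
  also have "\<dots> = (\<integral>\<^sup>+\<omega>. ennreal (v - P' \<omega>) * g (rebound \<omega> v) \<partial>\<mu>)"
  proof (rule nn_integral_cong)
    fix \<omega>
    have "ennreal (v - P' \<omega>) = ennreal v * ennreal (1 + P' \<omega> / (- v))"
      using pos by (simp add: ennreal_mult'[symmetric] right_diff_distrib)
    then show "?G (\<omega> + \<psi> (P \<omega> / (- v))) * ennreal (1 + P' \<omega> / (- v))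
        = ennreal (v - P' \<omega>) * g (rebound \<omega> v)"
      using pp_step_launch[OF pos(2), of \<omega>] by (simp add: launch_def mult_ac)
  qed
  finally show ?thesis .
qed

lemma nn_integral_rebound:
  assumes [measurable]: "g \<in> borel_measurable phase_space"
  shows "(\<integral>\<^sup>+v. \<integral>\<^sup>+\<omega>. ennreal (v - P' \<omega>) * g (rebound \<omega> v) \<partial>\<mu> \<partial>lborel)
    = (\<integral>\<^sup>+v. \<integral>\<^sup>+\<omega>. ennreal (v + P' \<omega>) * g (\<omega> + \<psi> (P \<omega> / v), v) \<partial>\<mu> \<partial>lborel)"
proof -
  have shift: "(\<integral>\<^sup>+v. ennreal (v + P' \<omega>) * g (\<omega> + \<psi> (P \<omega> / v), v) \<partial>lborel)
      = (\<integral>\<^sup>+v. ennreal (v - P' \<omega>) * g (rebound \<omega> v) \<partial>lborel)" for \<omega>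
  proof -
    have "(\<integral>\<^sup>+v. ennreal (v + P' \<omega>) * g (\<omega> + \<psi> (P \<omega> / v), v) \<partial>lborel)
        = ennreal \<bar>1\<bar> * (\<integral>\<^sup>+v. ennreal (- 2 * P' \<omega> + 1 * v + P' \<omega>)
            * g (\<omega> + \<psi> (P \<omega> / (- 2 * P' \<omega> + 1 * v)), - 2 * P' \<omega> + 1 * v) \<partial>lborel)"
      by (rule nn_integral_real_affine) simp_all
    then show ?thesis by (simp add: rebound_def)
  qed
  have "(\<integral>\<^sup>+v. \<integral>\<^sup>+\<omega>. ennreal (v - P' \<omega>) * g (rebound \<omega> v) \<partial>\<mu> \<partial>lborel)
      = (\<integral>\<^sup>+\<omega>. \<integral>\<^sup>+v. ennreal (v - P' \<omega>) * g (rebound \<omega> v) \<partial>lborel \<partial>\<mu>)"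
    by (rule phase_space.Fubini') measurable
  also have "\<dots> = (\<integral>\<^sup>+v. \<integral>\<^sup>+\<omega>. ennreal (v + P' \<omega>) * g (\<omega> + \<psi> (P \<omega> / v), v) \<partial>\<mu> \<partial>lborel)"
    unfolding shift[symmetric] by (rule phase_space.Fubini'[symmetric]) measurable
  finally show ?thesis .
qed

lemma nn_integral_return:
  assumes v: "fast_speed < v" and [measurable]: "g \<in> borel_measurable borel"
  shows "(\<integral>\<^sup>+\<omega>. ennreal (v + P' \<omega>) * g (\<omega> + \<psi> (P \<omega> / v)) \<partial>\<mu>) = (\<integral>\<^sup>+\<omega>. ennreal v * g \<omega> \<partial>\<mu>)"
proof -
  have pos: "0 < v" using v fast_speed_nonneg by simp
  then have "ennreal (v + P' \<omega>) = ennreal v * ennreal (1 + P' \<omega> / v)" for \<omega>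
    by (simp add: ennreal_mult'[symmetric] distrib_left)
  then show ?thesis
    using nn_integral_drift[of v "\<lambda>\<omega>. ennreal v * g \<omega>"] v pos by (simp add: mult_ac)
qed

lemma emeasure_pp_step_vimage_le:
  assumes B[measurable]: "B \<in> sets phase_space" and fast: "\<And>x. x \<in> B \<Longrightarrow> fast_speed < snd x"
  shows "emeasure liouville {x. fast_speed < snd x \<and> pp_step x \<in> B} \<le> emeasure liouville B"
proof -
  let ?V = "{x. fast_speed < snd x \<and> pp_step x \<in> B}"
  have "{x \<in> space phase_space. fast_speed < snd x \<and> pp_step x \<in> B} \<in> sets phase_space"
    by measurable
  then have "emeasure liouville ?V = (\<integral>\<^sup>+v. \<integral>\<^sup>+\<omega>. ennreal v * indicator ?V (\<omega>, v) \<partial>\<mu> \<partial>lborel)"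
    by (intro emeasure_liouville) simp
  also have "\<dots> \<le> (\<integral>\<^sup>+v. \<integral>\<^sup>+\<omega>. ennreal (v - P' \<omega>) * indicator B (rebound \<omega> v) \<partial>\<mu> \<partial>lborel)"
  proof (rule nn_integral_mono)
    fix v
    have "(\<integral>\<^sup>+\<omega>. ennreal v * indicator ?V (\<omega>, v) \<partial>\<mu>)
        = (if fast_speed < v then \<integral>\<^sup>+\<omega>. ennreal v * indicator B (pp_step (\<omega>, v)) \<partial>\<mu> else 0)"
      by (auto intro!: nn_integral_cong split: split_indicator)
    also have "\<dots> \<le> (\<integral>\<^sup>+\<omega>. ennreal (v - P' \<omega>) * indicator B (rebound \<omega> v) \<partial>\<mu>)"
      by (simp add: nn_integral_pp_step)
    finally show "(\<integral>\<^sup>+\<omega>. ennreal v * indicator ?V (\<omega>, v) \<partial>\<mu>)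
        \<le> (\<integral>\<^sup>+\<omega>. ennreal (v - P' \<omega>) * indicator B (rebound \<omega> v) \<partial>\<mu>)" .
  qed
  also have "\<dots> = (\<integral>\<^sup>+v. \<integral>\<^sup>+\<omega>. ennreal (v + P' \<omega>) * indicator B (\<omega> + \<psi> (P \<omega> / v), v) \<partial>\<mu> \<partial>lborel)"
    by (rule nn_integral_rebound) measurable
  also have "\<dots> = (\<integral>\<^sup>+v. \<integral>\<^sup>+\<omega>. ennreal v * indicator B (\<omega>, v) \<partial>\<mu> \<partial>lborel)"
  proof (rule nn_integral_cong)
    fix v
    have [measurable]: "(\<lambda>\<omega>. indicator B (\<omega>, v) :: ennreal) \<in> borel_measurable borel" by measurable
    show "(\<integral>\<^sup>+\<omega>. ennreal (v + P' \<omega>) * indicator B (\<omega> + \<psi> (P \<omega> / v), v) \<partial>\<mu>)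
        = (\<integral>\<^sup>+\<omega>. ennreal v * indicator B (\<omega>, v) \<partial>\<mu>)"
    proof (cases "fast_speed < v")
      case True
      then show ?thesis by (rule nn_integral_return) measurable
    next
      case False
      then have "(\<omega>, v) \<notin> B" for \<omega> using fast[of "(\<omega>, v)"] by auto
      then show ?thesis by simp
    qed
  qed
  also have "\<dots> = emeasure liouville B" by (rule emeasure_liouville[OF B, symmetric])
  finally show ?thesis .
qed

section \<open>The adiabatic invariant\<close>

definition adiabatic :: "'a \<times> real \<Rightarrow> real" where "adiabatic x = P (fst x) * snd x"

lemma measurable_adiabatic [measurable]: "adiabatic \<in> borel_measurable phase_space"
  unfolding adiabatic_def[abs_def] by measurable

lemma adiabatic_drift:
  assumes "0 < e"
  shows "\<forall>\<^sub>F v in at_infinity. \<forall>\<omega>. \<bar>adiabatic (\<omega> + \<psi> (P \<omega> / v), v)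
    - (P \<omega> * v + P' \<omega> * P \<omega> + P'' \<omega> / 2 * (P \<omega>)\<^sup>2 / v)\<bar> \<le> e / \<bar>v\<bar>"
proof -
  have "0 < e / b\<^sup>2" using assms b_pos by simp
  from flow_Taylor_uniform[OF P_C2 this]
  obtain d where d: "0 < d" and Taylor: "\<And>h \<omega>. \<bar>h\<bar> < d \<Longrightarrow>
      \<bar>P (\<omega> + \<psi> h) - (P \<omega> + P' \<omega> * h + P'' \<omega> / 2 * h\<^sup>2)\<bar> \<le> e / b\<^sup>2 * h\<^sup>2"
    by (auto simp: eventually_nhds_metric dist_real_def)
  have "\<bar>adiabatic (\<omega> + \<psi> (P \<omega> / v), v)
      - (P \<omega> * v + P' \<omega> * P \<omega> + P'' \<omega> / 2 * (P \<omega>)\<^sup>2 / v)\<bar> \<le> e / \<bar>v\<bar>"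
    if v: "b / d + 1 \<le> \<bar>v\<bar>" for v \<omega>
  proof -
    define h where "h = P \<omega> / v"
    have "0 < b / d" using b_pos d by simp
    with v have "b / d < \<bar>v\<bar>" "v \<noteq> 0" by auto
    then have "b < d * \<bar>v\<bar>" using d by (simp add: field_simps)
    then have "\<bar>h\<bar> < d"
      using P_pos[of \<omega>] P_le[of \<omega>] \<open>v \<noteq> 0\<close> by (simp add: h_def abs_divide divide_less_eq)
    have "P \<omega> * v + P' \<omega> * P \<omega> + P'' \<omega> / 2 * (P \<omega>)\<^sup>2 / v
        = (P \<omega> + P' \<omega> * h + P'' \<omega> / 2 * h\<^sup>2) * v"
      using \<open>v \<noteq> 0\<close> by (simp add: h_def field_simps power2_eq_square)
    then have "\<bar>adiabatic (\<omega> + \<psi> h, v) - (P \<omega> * v + P' \<omega> * P \<omega> + P'' \<omega> / 2 * (P \<omega>)\<^sup>2 / v)\<bar>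
        = \<bar>P (\<omega> + \<psi> h) - (P \<omega> + P' \<omega> * h + P'' \<omega> / 2 * h\<^sup>2)\<bar> * \<bar>v\<bar>"
      by (simp add: adiabatic_def abs_mult flip: left_diff_distrib)
    also have "\<dots> \<le> e / b\<^sup>2 * h\<^sup>2 * \<bar>v\<bar>"
      by (intro mult_right_mono Taylor \<open>\<bar>h\<bar> < d\<close>) simp
    also have "\<dots> = e / \<bar>v\<bar> * ((P \<omega>)\<^sup>2 / b\<^sup>2)"
      using \<open>v \<noteq> 0\<close> by (simp add: h_def power_divide power2_eq_square abs_if)
    also have "\<dots> \<le> e / \<bar>v\<bar> * 1"
      using P_pos[of \<omega>] P_le[of \<omega>] assms
      by (intro mult_left_mono) (auto simp: power_mono divide_le_eq_1)
    finally show ?thesis by (simp add: h_def)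
  qed
  then show ?thesis unfolding eventually_at_infinity by auto
qed

lemma quadratic_terms_diff_le:
  assumes K: "\<bar>P'' \<omega>\<bar> \<le> K" and v: "2 * fast_speed < v" "K * b\<^sup>2 * fast_speed \<le> e * v"
  shows "P'' \<omega> / 2 * (P \<omega>)\<^sup>2 / (v - 2 * P' \<omega>) - P'' \<omega> / 2 * (P \<omega>)\<^sup>2 / v \<le> e / v"
proof -
  define u where "u = v - 2 * P' \<omega>"
  define q where "q = P'' \<omega> / 2 * (P \<omega>)\<^sup>2"
  have u: "v / 2 \<le> u" "0 < u" "0 < v"
    using v(1) two_abs_P'_le[of \<omega>] fast_speed_nonneg by (auto simp: u_def)
  have "0 \<le> K" using K by linarith
  then have "0 \<le> e * v"
    using v(2) fast_speed_nonneg by (meson mult_nonneg_nonneg order_trans zero_le_power2)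
  then have "0 \<le> e" using u(3) by (simp add: zero_le_mult_iff)
  have "\<bar>P'' \<omega>\<bar> * (P \<omega>)\<^sup>2 \<le> K * b\<^sup>2"
    using K \<open>0 \<le> K\<close> P_pos[of \<omega>] P_le[of \<omega>] by (intro mult_mono power_mono) auto
  then have "\<bar>q\<bar> * \<bar>2 * P' \<omega>\<bar> \<le> K * b\<^sup>2 / 2 * fast_speed"
    using two_abs_P'_le[of \<omega>] \<open>0 \<le> K\<close> by (intro mult_mono) (auto simp: q_def abs_mult)
  also have "\<dots> \<le> e * (v / 2)" using v(2) by simp
  also have "\<dots> \<le> e * u" using u(1) \<open>0 \<le> e\<close> by (intro mult_left_mono)
  finally have "q * (2 * P' \<omega>) \<le> e * u" by (simp add: abs_mult[symmetric] abs_le_iff)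
  then have "q * (2 * P' \<omega>) / u / v \<le> e / v"
    using u by (intro divide_right_mono) (simp_all add: divide_le_eq)
  moreover have "q / u - q / v = q * (2 * P' \<omega>) / u / v"
    using u by (simp add: u_def field_simps)
  ultimately show ?thesis by (simp add: u_def q_def)
qed

text \<open>For a uniformly moving wall \<open>P \<omega> * v\<close> is an exact invariant; expanding both flights around
  the impact at the moving wall, all terms but the difference of the two quadratic ones cancel.\<close>
lemma adiabatic_rebound_le:
  assumes "0 < e"
  shows "\<forall>\<^sub>F v in at_top. \<forall>\<omega>.
    adiabatic (rebound \<omega> v) \<le> adiabatic (launch \<omega> v, v) + e / v"
proof -
  obtain K where K: "\<And>\<omega>. \<bar>P'' \<omega>\<bar> \<le> K"
    using bounded_range_continuous[OF continuous_P''] by (auto simp: bounded_iff)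
  define \<delta> where "\<delta> = e / 4"
  have \<delta>: "0 < \<delta>" using assms by (simp add: \<delta>_def)
  from adiabatic_drift[OF this] obtain V where expansion: "\<And>v \<omega>. V \<le> \<bar>v\<bar> \<Longrightarrow>
      \<bar>adiabatic (\<omega> + \<psi> (P \<omega> / v), v)
        - (P \<omega> * v + P' \<omega> * P \<omega> + P'' \<omega> / 2 * (P \<omega>)\<^sup>2 / v)\<bar> \<le> \<delta> / \<bar>v\<bar>"
    by (auto simp: eventually_at_infinity)
  have "\<forall>\<^sub>F v in at_top. 2 * fast_speed < v \<and> 2 * V \<le> v \<and> K * b\<^sup>2 * fast_speed / \<delta> \<le> v"
    by (intro eventually_conj eventually_gt_at_top eventually_ge_at_top)
  then show ?thesis
  proof (eventually_elim, intro allI)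
    fix v \<omega> assume v: "2 * fast_speed < v \<and> 2 * V \<le> v \<and> K * b\<^sup>2 * fast_speed / \<delta> \<le> v"
    define u where "u = v - 2 * P' \<omega>"
    define q where "q = P'' \<omega> / 2 * (P \<omega>)\<^sup>2"
    have u: "v / 2 \<le> u" "0 < v"
      using v two_abs_P'_le[of \<omega>] fast_speed_nonneg by (auto simp: u_def)
    have "\<bar>adiabatic (rebound \<omega> v) - (P \<omega> * u + P' \<omega> * P \<omega> + q / u)\<bar> \<le> \<delta> / u"
      using expansion[of u \<omega>] u v by (simp add: rebound_def u_def q_def)
    moreover have "\<bar>- adiabatic (launch \<omega> v, v) - (- (P \<omega> * v) + P' \<omega> * P \<omega> - q / v)\<bar> \<le> \<delta> / v"
      using expansion[of "- v" \<omega>] u v by (simp add: adiabatic_def launch_def q_def)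
    moreover have "P \<omega> * u + P' \<omega> * P \<omega> = P \<omega> * v - P' \<omega> * P \<omega>"
      by (simp add: u_def algebra_simps)
    moreover have "q / u - q / v \<le> \<delta> / v"
      unfolding u_def q_def using K v \<delta>
      by (intro quadratic_terms_diff_le[of _ K]) (auto simp: field_simps)
    moreover have "\<delta> / u \<le> 2 * (\<delta> / v)"
      using u \<delta> by (simp add: field_simps)
    moreover have "e / v = 4 * (\<delta> / v)" by (simp add: \<delta>_def)
    ultimately show "adiabatic (rebound \<omega> v) \<le> adiabatic (launch \<omega> v, v) + e / v"
      by linarith
  qed
qed

lemma adiabatic_pp_step_le:
  assumes "0 < e"
  shows "\<forall>\<^sub>F v in at_top. \<forall>\<omega>. adiabatic (pp_step (\<omega>, v)) \<le> adiabatic (\<omega>, v) + e / v"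
  using adiabatic_rebound_le[OF assms] eventually_gt_at_top[of v_star]
proof eventually_elim
  fix v assume le: "\<forall>\<omega>. adiabatic (rebound \<omega> v) \<le> adiabatic (launch \<omega> v, v) + e / v"
    and v: "v_star < v"
  show "\<forall>\<omega>. adiabatic (pp_step (\<omega>, v)) \<le> adiabatic (\<omega>, v) + e / v"
  proof
    fix \<omega>
    from le have "adiabatic (rebound (wall_phase \<omega> v) v)
        \<le> adiabatic (launch (wall_phase \<omega> v) v, v) + e / v" ..
    then show "adiabatic (pp_step (\<omega>, v)) \<le> adiabatic (\<omega>, v) + e / v"
      using v by (simp add: launch_wall_phase pp_step_def)
  qed
qed

lemma sets_adiabatic_band [measurable]: "{x. c \<le> adiabatic x \<and> adiabatic x \<le> d} \<in> sets phase_space"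
proof -
  have "{x \<in> space phase_space. c \<le> adiabatic x \<and> adiabatic x \<le> d} \<in> sets phase_space" by measurable
  then show ?thesis by simp
qed

lemma emeasure_adiabatic_band_le:
  assumes "0 < d" "c \<le> d"
  shows "emeasure liouville {x. c \<le> adiabatic x \<and> adiabatic x \<le> d} \<le> ennreal (d * (d - c) / a\<^sup>2)"
proof -
  let ?B = "{x. c \<le> adiabatic x \<and> adiabatic x \<le> d}"
  have "(\<integral>\<^sup>+v. ennreal v * indicator ?B (\<omega>, v) \<partial>lborel) \<le> ennreal (d * (d - c) / a\<^sup>2)" for \<omega>
  proof -
    have "ennreal v * indicator ?B (\<omega>, v) \<le> ennreal (d / a) * indicator {c / P \<omega>..d / P \<omega>} v" for v
    proof (cases "(\<omega>, v) \<in> ?B")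
      case True
      then have v: "v \<in> {c / P \<omega>..d / P \<omega>}"
        using P_pos[of \<omega>] by (auto simp: adiabatic_def field_simps)
      then have "v \<le> d / P \<omega>" by simp
      also have "\<dots> \<le> d / a" using assms a_pos P_ge by (intro divide_left_mono) (auto simp: P_pos)
      finally show ?thesis using v True by (simp add: ennreal_leI)
    qed simp
    then have "(\<integral>\<^sup>+v. ennreal v * indicator ?B (\<omega>, v) \<partial>lborel)
        \<le> (\<integral>\<^sup>+v. ennreal (d / a) * indicator {c / P \<omega>..d / P \<omega>} v \<partial>lborel)"
      by (rule nn_integral_mono)
    also have "\<dots> = ennreal (d / a) * ennreal ((d - c) / P \<omega>)"
      using assms P_pos[of \<omega>]
      by (simp add: nn_integral_cmult_indicator divide_right_mono diff_divide_distrib)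
    also have "\<dots> = ennreal (d / a * ((d - c) / P \<omega>))"
      using assms a_pos P_pos[of \<omega>] by (intro ennreal_mult[symmetric]) auto
    also have "\<dots> \<le> ennreal (d / a * ((d - c) / a))"
      using assms a_pos P_ge[of \<omega>]
      by (intro ennreal_leI mult_left_mono divide_left_mono) (auto simp: P_pos)
    finally show ?thesis by (simp add: power2_eq_square)
  qed
  then have "(\<integral>\<^sup>+\<omega>. \<integral>\<^sup>+v. ennreal v * indicator ?B (\<omega>, v) \<partial>lborel \<partial>\<mu>)
      \<le> (\<integral>\<^sup>+\<omega>. ennreal (d * (d - c) / a\<^sup>2) \<partial>\<mu>)"
    by (intro nn_integral_mono)
  moreover have "emeasure liouville ?B = (\<integral>\<^sup>+\<omega>. \<integral>\<^sup>+v. ennreal v * indicator ?B (\<omega>, v) \<partial>lborel \<partial>\<mu>)"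
    unfolding emeasure_liouville[OF sets_adiabatic_band] by (rule phase_space.Fubini') measurable
  ultimately show ?thesis using emeasure_space_1 by simp
qed

section \<open>Escaping orbits\<close>

definition fast_escape :: "('a \<times> real) set" where
  "fast_escape = {x. (\<forall>n. fast_speed < snd ((pp_step ^^ n) x)) \<and>
     filterlim (\<lambda>n. snd ((pp_step ^^ n) x)) at_top sequentially}"

lemma sets_fast_escape [measurable]: "fast_escape \<in> sets phase_space"
proof -
  have "filterlim f at_top sequentially \<longleftrightarrow> (\<forall>k::nat. \<forall>\<^sub>F n in sequentially. real k \<le> f n)" for f
    unfolding filterlim_at_top by (meson eventually_mono order_trans real_arch_simple)
  then have "fast_escape = {x \<in> space phase_space. (\<forall>n. fast_speed < snd ((pp_step ^^ n) x)) \<and>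
      (\<forall>k::nat. \<forall>\<^sub>F n in sequentially. real k \<le> snd ((pp_step ^^ n) x))}"
    by (simp add: fast_escape_def)
  also have "\<dots> \<in> sets phase_space" by measurable
  finally show ?thesis .
qed

lemma fast_speed_less_fast_escape: "x \<in> fast_escape \<Longrightarrow> fast_speed < snd x"
  by (auto simp: fast_escape_def dest: spec[of _ 0])

lemma pp_step_in_fast_escape:
  assumes "x \<in> fast_escape"
  shows "pp_step x \<in> fast_escape"
proof -
  have shift: "(pp_step ^^ n) (pp_step x) = (pp_step ^^ Suc n) x" for n by (simp add: funpow_swap1)
  show ?thesis
    using assms filterlim_sequentially_Suc[of "\<lambda>n. snd ((pp_step ^^ n) x)"]
    unfolding fast_escape_def mem_Collect_eq shift by blast
qed

sublocale fast_escape: subinvariant_map liouville pp_step fast_escape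
proof
  show "pp_step \<in> liouville \<rightarrow>\<^sub>M liouville" "fast_escape \<in> sets liouville" by measurable
  show "emeasure liouville (fast_escape \<inter> pp_step -` B) \<le> emeasure liouville B"
    if B: "B \<in> sets liouville" "B \<subseteq> fast_escape" for B
  proof -
    have [measurable]: "B \<in> sets phase_space" using B by simp
    have "{x \<in> space phase_space. fast_speed < snd x \<and> pp_step x \<in> B} \<in> sets phase_space"
      by measurable
    then have "emeasure liouville (fast_escape \<inter> pp_step -` B)
        \<le> emeasure liouville {x. fast_speed < snd x \<and> pp_step x \<in> B}"
      by (intro emeasure_mono) (auto intro: fast_speed_less_fast_escape)
    also have "\<dots> \<le> emeasure liouville B"
      using B by (intro emeasure_pp_step_vimage_le) (auto intro: fast_speed_less_fast_escape)
    finally show ?thesis .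
  qed
qed (rule pp_step_in_fast_escape)

lemma filterlim_adiabatic_fast_escape:
  assumes x: "x \<in> fast_escape"
  shows "filterlim (\<lambda>n. adiabatic ((pp_step ^^ n) x)) at_top sequentially"
proof (rule filterlim_at_top_mono)
  have "filterlim (\<lambda>n. snd ((pp_step ^^ n) x)) at_top sequentially"
    using x by (simp add: fast_escape_def)
  then show "filterlim (\<lambda>n. a * snd ((pp_step ^^ n) x)) at_top sequentially"
    by (intro filterlim_tendsto_pos_mult_at_top[OF tendsto_const a_pos])
  have "0 \<le> snd ((pp_step ^^ n) x)" for n
    using fast_speed_less_fast_escape[OF fast_escape.funpow_in_domain[OF x]] fast_speed_nonneg
    by (meson less_imp_le order_trans)
  then show "\<forall>\<^sub>F n in sequentially. a * snd ((pp_step ^^ n) x) \<le> adiabatic ((pp_step ^^ n) x)"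
    unfolding adiabatic_def by (intro always_eventually allI mult_right_mono P_ge)
qed

lemma emeasure_crossing_le:
  assumes "0 < e"
  shows "\<forall>\<^sub>F c in at_top.
    emeasure liouville {x \<in> fast_escape. adiabatic x \<le> c \<and> c < adiabatic (pp_step x)} \<le> ennreal e"
proof -
  define \<eta> where "\<eta> = e * a\<^sup>2 / (2 * b)"
  have \<eta>: "0 < \<eta>" using assms a_pos b_pos by (simp add: \<eta>_def)
  obtain V where step: "\<And>v \<omega>. V \<le> v \<Longrightarrow> adiabatic (pp_step (\<omega>, v)) \<le> adiabatic (\<omega>, v) + \<eta> / v"
    using adiabatic_pp_step_le[OF \<eta>] by (auto simp: eventually_at_top_linorder)
  have "\<forall>\<^sub>F c in at_top. 0 < c \<and> 2 * b * V \<le> c"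
    by (intro eventually_conj eventually_gt_at_top eventually_ge_at_top)
  then show ?thesis
  proof eventually_elim
    fix c assume c: "0 < c \<and> 2 * b * V \<le> c"
    let ?g = "2 * b * \<eta> / c"
    have band: "c - ?g \<le> adiabatic x"
      if x: "x \<in> fast_escape" "c < adiabatic (pp_step x)" for x
    proof -
      have v: "fast_speed < snd x" using x(1) by (rule fast_speed_less_fast_escape)
      have "c < P (fst (pp_step x)) * snd (pp_step x)" using x(2) by (simp add: adiabatic_def)
      also have "\<dots> \<le> b * (2 * snd x)"
        using snd_pp_step_bounds[OF v] b_pos P_le by (intro mult_mono) auto
      finally have cv: "c / (2 * b) < snd x" using b_pos by (simp add: field_simps)
      moreover have "V \<le> c / (2 * b)" using c b_pos by (simp add: field_simps)
      ultimately have "adiabatic (pp_step x) \<le> adiabatic x + \<eta> / snd x"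
        using step[of "snd x" "fst x"] by simp
      also have "\<eta> / snd x \<le> \<eta> / (c / (2 * b))"
        using cv c b_pos \<eta> by (intro frac_le) auto
      finally show ?thesis using x(2) by (simp add: mult_ac)
    qed
    have "emeasure liouville {x \<in> fast_escape. adiabatic x \<le> c \<and> c < adiabatic (pp_step x)}
        \<le> emeasure liouville {x. c - ?g \<le> adiabatic x \<and> adiabatic x \<le> c}"
      using band by (intro emeasure_mono) (simp_all only: sets_liouville sets_adiabatic_band, blast)
    also have "\<dots> \<le> ennreal (c * (c - (c - ?g)) / a\<^sup>2)"
      using c b_pos \<eta> by (intro emeasure_adiabatic_band_le) auto
    also have "c * (c - (c - ?g)) / a\<^sup>2 = e" using c a_pos b_pos by (simp add: \<eta>_def)
    finally show "emeasure liouville {x \<in> fast_escape. adiabatic x \<le> c \<and> c < adiabatic (pp_step x)}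
        \<le> ennreal e" .
  qed
qed

lemma null_sets_fast_escape: "fast_escape \<in> null_sets phase_space"
proof (rule null_sets_liouville_imp_null_sets)
  show "fast_escape \<in> null_sets liouville"
    using filterlim_adiabatic_fast_escape eventually_frequently[OF _ emeasure_crossing_le]
    by (intro fast_escape.null_sets_escaping_domain[where W=adiabatic]) auto
  show "0 < snd x" if "x \<in> fast_escape" for x
    using fast_speed_less_fast_escape[OF that] fast_speed_nonneg by simp
qed

lemma funpow_pp_step_eq_pp_orbit:
  assumes "\<And>i. v_star < snd (pp_orbit (forcing \<omega>) y i)"
  shows "(pp_step ^^ n) (\<omega> + \<psi> (fst y), snd y)
    = (\<omega> + \<psi> (fst (pp_orbit (forcing \<omega>) y n)), snd (pp_orbit (forcing \<omega>) y n))"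
  using assms by (induction n) (simp_all add: pp_orbit_def pp_step_pp_map)

lemma escaping_set_subset_flow_line:
  "escaping_set (forcing \<omega>) fast_speed \<subseteq> {(t, v). (\<omega> + \<psi> t, v) \<in> fast_escape}"
proof
  fix y assume y: "y \<in> escaping_set (forcing \<omega>) fast_speed"
  then have "v_star < snd (pp_orbit (forcing \<omega>) y i)" for i
    using v_star_le_fast_speed by (auto simp: escaping_set_def intro: le_less_trans)
  with y have "(\<omega> + \<psi> (fst y), snd y) \<in> fast_escape"
    by (simp add: fast_escape_def escaping_set_def funpow_pp_step_eq_pp_orbit)
  then show "y \<in> {(t, v). (\<omega> + \<psi> t, v) \<in> fast_escape}" by (simp add: case_prod_beta)
qed

lemma AE_negligible_fast_escaping_set:
  "AE \<omega> in \<mu>. negligible (escaping_set (forcing \<omega>) fast_speed)"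
  using AE_null_sets_flow_line[OF lborel.sigma_finite_measure_axioms null_sets_fast_escape]
proof eventually_elim
  fix \<omega>
  let ?S = "{(t, v). (\<omega> + \<psi> t, v) \<in> fast_escape}"
  assume "{(t, v) \<in> space (lborel \<Otimes>\<^sub>M lborel). (\<omega> + \<psi> t, v) \<in> fast_escape}
    \<in> null_sets (lborel \<Otimes>\<^sub>M lborel)"
  then have "?S \<in> null_sets lborel" by (simp add: lborel_prod)
  then have "negligible ?S" by (simp add: negligible_iff_null_sets null_sets_completionI)
  then show "negligible (escaping_set (forcing \<omega>) fast_speed)"
    using escaping_set_subset_flow_line by (rule negligible_subset)
qed

end

theorem theorem5p1:
  fixes \<psi> :: "real \<Rightarrow> 'a::{topological_ab_group_add, metric_space}"
    and \<mu> :: "'a measure"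
    and P :: "'a \<Rightarrow> real"
    and a b :: real
  assumes compact_Omega: "compact (UNIV :: 'a set)"
    and psi_cont: "continuous_on UNIV \<psi>"
    and psi_hom: "\<And>s t. \<psi> (s + t) = \<psi> s + \<psi> t"
    and psi_dense: "closure (range \<psi>) = UNIV"
    and haar: "haar_prob \<mu>"
    and ab: "0 < a" "a < b"
    and P_C2: "C2_psi \<psi> P"
    and P_bounds: "\<And>\<omega>. a \<le> P \<omega> \<and> P \<omega> \<le> b"
  shows "AE \<omega> in \<mu>.
           escaping_set (\<lambda>t. P (\<omega> + \<psi> t))
                        (2 * max (Sup (range (dpsi \<psi> P))) 0) \<in> null_sets lebesgue"
proof -
  interpret ping_pong \<psi> \<mu> P a b
    using assms by unfold_locales auto
  have "AE \<omega> in \<mu>. negligible (escaping_set (forcing \<omega>) fast_speed)"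
    by (rule AE_negligible_fast_escaping_set)
  then have "AE \<omega> in \<mu>. negligible (escaping_set (forcing \<omega>) v_star)"
    by eventually_elim (rule flow_line.negligible_escaping_set)
  then show ?thesis
    by (simp only: negligible_iff_null_sets v_star_def)
qed

end
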